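(* Let $(\phi(\tau),\ \tau\in\mathcal{T}_0^p)$ be an admissible family. Let $\tau,\tilde\tau\in\mathcal{T}_0^p$ and put $A:=\{\tau=\tilde\tau\}$ and $B:=\{\tau>\tilde\tau\}$. Then $$V^A(\tau)=V^A(\tilde\tau)\ \text{ a.s.}\qquad\text{and}\qquad V^{A+}(\tau)=V^{A+}(\tilde\tau)\ \text{ a.s.}$$ Moreover, $$E[\phi(\tau)\,|\,\mathcal{F}_{\tilde\tau^-}]\,\mathbf{1}_B\le V^{B+}(\tilde\tau)\quad\text{a.s.}$$
   Context: Fix $T\in(0,\infty)$ and a filtered probability space $(\Omega,\mathbb{F}=(\mathcal{F}_t)_{t\in[0,T]},P)$ whose filtration satisfies the usual conditions (right-continuity and completeness) and is not quasi-left-continuous; $\mathcal{F}_0$ contains only sets of probability $0$ or $1$. For a stopping time $S$, $\mathcal{F}_{S^-}$ is the usual $\sigma$-field of events strictly before $S$ (with $\mathcal{F}_{0^-}=\mathcal{F}_0$). $\mathcal{T}_0^p$ is the set of predictable stopping times with values in $[0,T]$. For $S\in\mathcal{T}_0^p$, $\mathcal{T}_S^p$ is the set of $\tau\in\mathcal{T}_0^p$ with $\tau\ge S$ a.s., and $\mathcal{T}_{S^+}^p$ is the set of $\tau\in\mathcal{T}_0^p$ with $\tau>S$ a.s. on $\{S<T\}$ and $\tau=T$ a.s. on $\{S=T\}$. An admissible family is a family $(\phi(\tau),\ \tau\in\mathcal{T}_0^p)$ such that (1) each $\phi(\tau)$ is an $\mathcal{F}_{\tau^-}$-measurable $[0,\infty]$-valued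 random variable; (2) for all $\tau,\tau'\in\mathcal{T}_0^p$, $\phi(\tau)=\phi(\tau')$ a.s. on $\{\tau=\tau'\}$. For an event $C$ and $\sigma\in\mathcal{T}_0^p$ with $C\in\mathcal{F}_{\sigma^-}$, put $V^C(\sigma):=\operatorname{ess\,sup}_{\theta\in\mathcal{T}_\sigma^p}E[\phi(\theta)\mathbf{1}_C|\mathcal{F}_{\sigma^-}]$ and $V^{C+}(\sigma):=\operatorname{ess\,sup}_{\theta\in\mathcal{T}_{\sigma^+}^p}E[\phi(\theta)\mathbf{1}_C|\mathcal{F}_{\sigma^-}]$. (Since $\tau,\tilde\tau$ are predictable, $\{\tau=\tilde\tau\}\in\mathcal{F}_{\tau^-}\cap\mathcal{F}_{\tilde\tau^-}$ and $\{\tau>\tilde\tau\}\in\mathcal{F}_{\tilde\tau^-}$.) Convention: $0\cdot\infty=0$. *)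

theory Defs
  imports "HOL-Probability.Probability"
begin

text \<open>
  The filtration is indexed by all reals in order to use the library's notions of filtration and
  stopping time. Only \<open>F t\<close> for \<open>t \<in> {0..T}\<close> matters: a filtration on \<open>{0..T}\<close> extends by
  \<open>F 0\<close> to the left and by \<open>F T\<close> to the right, and for \<open>{0..T}\<close>-valued \<open>\<tau>\<close> the conditions in
  \<^const>\<open>stopping_time\<close> and \<^const>\<open>filtration.pre_sigma\<close> hold trivially for \<open>t < 0\<close> and follow from
  those at \<open>T\<close> for \<open>t > T\<close>.
\<close>

locale usual_filtered_space = prob_space M + filtration "space M" F
  for M :: "'a measure" and F :: "real \<Rightarrow> 'a measure" +
  fixes T :: real
  assumes horizon_pos: "0 < T"
    and subalgebra_F: "\<And>t. t \<in> {0..T} \<Longrightarrow> subalgebra M (F t)"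
    and right_continuous: "\<And>t. t \<in> {0..<T} \<Longrightarrow> sets (F t) = (\<Inter>s\<in>{t<..T}. sets (F s))"
    and complete_space: "complete_measure M" "null_sets M \<subseteq> sets (F 0)"
    and trivial_F0: "\<And>A. A \<in> sets (F 0) \<Longrightarrow> prob A = 0 \<or> prob A = 1"

definition stopping_times :: "'a measure \<Rightarrow> (real \<Rightarrow> 'a measure) \<Rightarrow> real \<Rightarrow> ('a \<Rightarrow> real) set" where
  "stopping_times M F T = {\<tau>. stopping_time F \<tau> \<and> (\<forall>\<omega>\<in>space M. \<tau> \<omega> \<in> {0..T})}"

text \<open>
  Predictability means being announced by a sequence of stopping times; nothing is required on
  \<open>{\<tau> = 0}\<close>, in accordance with the convention \<open>F\<^bsub>0-\<^esub> = F\<^bsub>0\<^esub>\<close>.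
\<close>

definition predictable_times :: "'a measure \<Rightarrow> (real \<Rightarrow> 'a measure) \<Rightarrow> real \<Rightarrow> ('a \<Rightarrow> real) set" where
  "predictable_times M F T = {\<tau> \<in> stopping_times M F T.
     \<exists>\<sigma> :: nat \<Rightarrow> 'a \<Rightarrow> real. (\<forall>n. \<sigma> n \<in> stopping_times M F T) \<and>
       (AE \<omega> in M. incseq (\<lambda>n. \<sigma> n \<omega>) \<and> (\<lambda>n. \<sigma> n \<omega>) \<longlonglongrightarrow> \<tau> \<omega> \<and>
                   (0 < \<tau> \<omega> \<longrightarrow> (\<forall>n. \<sigma> n \<omega> < \<tau> \<omega>)))}"

definition predictable_times_from ::
  "'a measure \<Rightarrow> (real \<Rightarrow> 'a measure) \<Rightarrow> real \<Rightarrow> ('a \<Rightarrow> real) \<Rightarrow> ('a \<Rightarrow> real) set" where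
  "predictable_times_from M F T S = {\<tau> \<in> predictable_times M F T. AE \<omega> in M. S \<omega> \<le> \<tau> \<omega>}"

definition predictable_times_after ::
  "'a measure \<Rightarrow> (real \<Rightarrow> 'a measure) \<Rightarrow> real \<Rightarrow> ('a \<Rightarrow> real) \<Rightarrow> ('a \<Rightarrow> real) set" where
  "predictable_times_after M F T S = {\<tau> \<in> predictable_times M F T.
     AE \<omega> in M. (S \<omega> < T \<longrightarrow> S \<omega> < \<tau> \<omega>) \<and> (S \<omega> = T \<longrightarrow> \<tau> \<omega> = T)}"

text \<open>
  The \<open>\<sigma>\<close>-field \<open>F\<^bsub>S-\<^esub>\<close> of events strictly before \<open>S\<close>. For \<open>S = 0\<close> the second family of generators
  contributes only the empty set, so \<open>F\<^bsub>0-\<^esub> = F\<^bsub>0\<^esub>\<close>.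
\<close>

definition strict_past ::
  "'a measure \<Rightarrow> (real \<Rightarrow> 'a measure) \<Rightarrow> real \<Rightarrow> ('a \<Rightarrow> real) \<Rightarrow> 'a measure" where
  "strict_past M F T S = sigma (space M)
     (sets (F 0) \<union> {A \<inter> {\<omega> \<in> space M. t < S \<omega>} | A t. t \<in> {0..T} \<and> A \<in> sets (F t)})"

definition quasi_left_continuous :: "'a measure \<Rightarrow> (real \<Rightarrow> 'a measure) \<Rightarrow> real \<Rightarrow> bool" where
  "quasi_left_continuous M F T \<longleftrightarrow> (\<forall>\<tau>\<in>predictable_times M F T.
     sets (strict_past M F T \<tau>) = sets (filtration.pre_sigma (space M) F \<tau>))"

definition admissible_family ::
  "'a measure \<Rightarrow> (real \<Rightarrow> 'a measure) \<Rightarrow> real \<Rightarrow> (('a \<Rightarrow> real) \<Rightarrow> 'a \<Rightarrow> ennreal) \<Rightarrow> bool" where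
  "admissible_family M F T \<phi> \<longleftrightarrow>
     (\<forall>\<tau>\<in>predictable_times M F T. \<phi> \<tau> \<in> borel_measurable (strict_past M F T \<tau>)) \<and>
     (\<forall>\<tau>\<in>predictable_times M F T. \<forall>\<tau>'\<in>predictable_times M F T.
        AE \<omega> in M. \<tau> \<omega> = \<tau>' \<omega> \<longrightarrow> \<phi> \<tau> \<omega> = \<phi> \<tau>' \<omega>)"

text \<open>
  The library's \<^const>\<open>esssup\<close> is the essential supremum of a single function. The essential supremum
  of a family is the a.s. least random variable dominating each member a.s.; it is determined up
  to a.s. equality, and \<open>ess_sup\<close> selects a version.
\<close>

definition is_ess_sup ::
  "'a measure \<Rightarrow> 'i set \<Rightarrow> ('i \<Rightarrow> 'a \<Rightarrow> ennreal) \<Rightarrow> ('a \<Rightarrow> ennreal) \<Rightarrow> bool" where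
  "is_ess_sup M I X Y \<longleftrightarrow>
     Y \<in> borel_measurable M \<and> (\<forall>i\<in>I. AE \<omega> in M. X i \<omega> \<le> Y \<omega>) \<and>
     (\<forall>Z\<in>borel_measurable M. (\<forall>i\<in>I. AE \<omega> in M. X i \<omega> \<le> Z \<omega>) \<longrightarrow> (AE \<omega> in M. Y \<omega> \<le> Z \<omega>))"

definition ess_sup :: "'a measure \<Rightarrow> 'i set \<Rightarrow> ('i \<Rightarrow> 'a \<Rightarrow> ennreal) \<Rightarrow> 'a \<Rightarrow> ennreal" where
  "ess_sup M I X = (SOME Y. is_ess_sup M I X Y)"

lemma ennreal_inverse_le_iff: "inverse b \<le> inverse a \<longleftrightarrow> a \<le> b" for a b :: ennreal
  including ennreal.lifting
  by transfer (meson ereal_inverse_antimono ereal_inverse_antimono_strict not_le)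

lemma (in prob_space) is_ess_sup_ess_sup:
  assumes X[measurable]: "\<And>i. i \<in> I \<Longrightarrow> X i \<in> borel_measurable M"
  shows "is_ess_sup M I X (ess_sup M I X)"
proof -
  define S where "S J \<omega> = (SUP i\<in>J. X i \<omega>)" for J \<omega>
  define \<J> where "\<J> = {J. countable J \<and> J \<subseteq> I}"
  define m where "m J = (\<integral>\<^sup>+\<omega>. inverse (1 + S J \<omega>) \<partial>M)" for J
  have S_meas[measurable]: "S J \<in> borel_measurable M" if "J \<in> \<J>" for J
    using that unfolding S_def \<J>_def by (auto intro!: borel_measurable_SUP)
  have m_anti: "m K \<le> m J" if "J \<subseteq> K" for J K
    unfolding m_def S_def using that
    by (intro nn_integral_mono ennreal_inverse_le_iff[THEN iffD2] add_left_mono SUP_subset_mono) auto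
  have "\<J> \<noteq> {}" by (auto simp: \<J>_def)
  then obtain f :: "nat \<Rightarrow> ennreal" where f: "range f \<subseteq> m ` \<J>" "(INF J\<in>\<J>. m J) = (INF n. f n)"
    using ennreal_Inf_countable_INF[of "m ` \<J>"] by (metis image_is_empty)
  then have "\<forall>n. \<exists>J\<in>\<J>. f n = m J" by blast
  then obtain J where J: "\<And>n. J n \<in> \<J>" "\<And>n. f n = m (J n)" by metis
  define K where "K = (\<Union>n. J n)"
  have K: "K \<in> \<J>" using J(1) by (auto simp: K_def \<J>_def)
  have mK: "m K \<le> m L" if "L \<in> \<J>" for L
  proof -
    have "m K \<le> (INF n. f n)"
      unfolding J(2) by (intro INF_greatest m_anti) (auto simp: K_def)
    also have "\<dots> \<le> m L" using f(2) that by (metis INF_lower)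
    finally show ?thesis .
  qed
  have "AE \<omega> in M. X i \<omega> \<le> S K \<omega>" if i: "i \<in> I" for i
  proof -
    have L: "insert i K \<in> \<J>" using i K by (auto simp: \<J>_def)
    have fin: "m (insert i K) \<noteq> \<infinity>"
    proof -
      have "m (insert i K) \<le> (\<integral>\<^sup>+\<omega>. 1 \<partial>M)"
        unfolding m_def by (intro nn_integral_mono) (use ennreal_inverse_le_iff[of _ 1] in auto)
      then show ?thesis using emeasure_space_1 by (auto simp: top_unique)
    qed
    have "AE \<omega> in M. inverse (1 + S K \<omega>) \<le> inverse (1 + S (insert i K) \<omega>)"
    proof (rule ccontr)
      assume "\<not> ?thesis"
      then have "m (insert i K) < m K"
        unfolding m_def
      proof (intro nn_integral_less)
        show "AE \<omega> in M. inverse (1 + S (insert i K) \<omega>) \<le> inverse (1 + S K \<omega>)"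
          unfolding S_def by (intro AE_I2 ennreal_inverse_le_iff[THEN iffD2] add_left_mono SUP_subset_mono) auto
      qed (use fin K L in \<open>simp_all add: m_def\<close>)
      with mK[OF L] show False by simp
    qed
    then show ?thesis
    proof (rule AE_mp, intro AE_I2 impI)
      fix \<omega> assume "inverse (1 + S K \<omega>) \<le> inverse (1 + S (insert i K) \<omega>)"
      then have "1 + S (insert i K) \<omega> \<le> 1 + S K \<omega>"
        by (simp add: ennreal_inverse_le_iff)
      then have "S (insert i K) \<omega> \<le> S K \<omega>"
        by (simp add: ennreal_add_left_cancel_le)
      then show "X i \<omega> \<le> S K \<omega>" by (simp add: S_def)
    qed
  qed
  moreover have "AE \<omega> in M. S K \<omega> \<le> Z \<omega>" if "\<forall>i\<in>I. AE \<omega> in M. X i \<omega> \<le> Z \<omega>" for Z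
  proof -
    have "AE \<omega> in M. \<forall>i\<in>K. X i \<omega> \<le> Z \<omega>"
      using K that by (intro AE_ball_countable[THEN iffD2]) (auto simp: \<J>_def)
    then show ?thesis by eventually_elim (auto simp: S_def intro: SUP_least)
  qed
  ultimately have "is_ess_sup M I X (S K)" using K by (auto simp: is_ess_sup_def)
  then show ?thesis unfolding ess_sup_def by (rule someI[of "is_ess_sup M I X"])
qed

definition value_on ::
  "'a measure \<Rightarrow> (real \<Rightarrow> 'a measure) \<Rightarrow> real \<Rightarrow> (('a \<Rightarrow> real) \<Rightarrow> 'a \<Rightarrow> ennreal) \<Rightarrow>
   'a set \<Rightarrow> ('a \<Rightarrow> real) \<Rightarrow> 'a \<Rightarrow> ennreal" where
  "value_on M F T \<phi> C \<sigma> = ess_sup M (predictable_times_from M F T \<sigma>)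
     (\<lambda>\<theta>. nn_cond_exp M (strict_past M F T \<sigma>) (\<lambda>\<omega>. \<phi> \<theta> \<omega> * indicator C \<omega>))"

definition value_on_plus ::
  "'a measure \<Rightarrow> (real \<Rightarrow> 'a measure) \<Rightarrow> real \<Rightarrow> (('a \<Rightarrow> real) \<Rightarrow> 'a \<Rightarrow> ennreal) \<Rightarrow>
   'a set \<Rightarrow> ('a \<Rightarrow> real) \<Rightarrow> 'a \<Rightarrow> ennreal" where
  "value_on_plus M F T \<phi> C \<sigma> = ess_sup M (predictable_times_after M F T \<sigma>)
     (\<lambda>\<theta>. nn_cond_exp M (strict_past M F T \<sigma>) (\<lambda>\<omega>. \<phi> \<theta> \<omega> * indicator C \<omega>))"

end

theory Submission
  imports Defs
begin

text \<open>
  Write \<open>F\<^bsub>S-\<^esub>\<close> for the strict past of \<open>S\<close>. The event \<open>A = {\<tau> = \<tau>'}\<close> lies in both \<open>F\<^bsub>\<tau>-\<^esub>\<close> and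
  \<open>F\<^bsub>\<tau>'-\<^esub>\<close>, since both times are predictable (\<open>le_in_strict_past\<close>), and on \<open>A\<close> the two
  \<open>\<sigma>\<close>-fields have the same trace (\<open>strict_past_trace\<close>). As conditional expectations are local
  (\<open>nn_cond_exp_eq_of_trace_eq\<close>), conditioning \<open>\<phi>(\<theta>) 1\<^bsub>A\<^esub>\<close> on either of them gives the same
  result, and by admissibility only the values of \<open>\<theta>\<close> on \<open>A\<close> enter.

  The equalities therefore reduce to a question about competitors: every \<open>\<theta>\<close> that competes for \<open>\<tau>\<close>
  must agree on \<open>A\<close> with one that competes for \<open>\<tau>'\<close>, the converse being symmetric. The time
  that equals \<open>\<theta>\<close> on \<open>A\<close> and \<open>T\<close> off \<open>A\<close> is of this kind, and the point is that it is predictable.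
  That the restriction of a predictable \<open>\<theta>\<close> to an event of \<open>F\<^bsub>\<theta>-\<^esub>\<close> is predictable is a classical
  theorem, proved through stationary decreasing limits of predictable times. For the events at
  hand there is a direct construction: if events \<open>D n\<close> known at the announcing times decrease to
  \<open>A\<close>, one announces \<open>\<theta>\<close> as long as \<open>D n\<close> holds and \<open>T\<close> from then on (\<open>predictable_restrictI\<close>).
  With announcing sequences \<open>\<sigma>\<close> of \<open>\<tau>\<close> and \<open>\<sigma>'\<close> of \<open>\<tau>'\<close>, the events \<open>{\<sigma> n < \<tau>'} \<inter> {\<sigma>' n < \<tau>}\<close> serve
  this purpose, apart from a correction at time \<open>0\<close> (\<open>predictable_restrict_eq\<close>).

  For the inequality, the competitor is \<open>\<tau>\<close> restricted to \<open>B = {\<tau> > \<tau>'}\<close>. It is predictable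
  because \<open>B\<close> is known at time \<open>\<tau>'\<close>, strictly before \<open>\<tau>\<close> (\<open>predictable_restrict_after\<close>).
\<close>

section \<open>Conditional expectations under locally equal sub-\<open>\<sigma>\<close>-fields\<close>

text \<open>
  A conditional expectation is local: multiplied by \<open>1\<^bsub>A\<^esub>\<close> with \<open>A \<in> G\<close>, it is \<open>G\<close>-measurable
  and vanishes off \<open>A\<close>, so only the trace of \<open>G\<close> on \<open>A\<close> matters for its measurability, and
  testing it on \<open>D \<in> H\<close> amounts to testing it on \<open>D \<inter> A \<in> G\<close>.
\<close>

lemma nn_cond_exp_eq_of_trace_eq:
  fixes X :: "'a \<Rightarrow> ennreal"
  assumes G: "sigma_finite_subalgebra M G" and H: "sigma_finite_subalgebra M H"
    and AG: "A \<in> sets G" and AH: "A \<in> sets H"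
    and GH: "\<And>C. C \<in> sets G \<Longrightarrow> C \<inter> A \<in> sets H"
    and HG: "\<And>C. C \<in> sets H \<Longrightarrow> C \<inter> A \<in> sets G"
    and X [measurable]: "X \<in> borel_measurable M"
  shows "AE \<omega> in M. nn_cond_exp M G (\<lambda>\<omega>. X \<omega> * indicator A \<omega>) \<omega> =
                    nn_cond_exp M H (\<lambda>\<omega>. X \<omega> * indicator A \<omega>) \<omega>"
proof -
  interpret G: sigma_finite_subalgebra M G by (rule G)
  interpret H: sigma_finite_subalgebra M H by (rule H)
  have spaces: "space G = space M" "space H = space M" and sub: "sets G \<subseteq> sets M" "sets H \<subseteq> sets M"
    using G.subalg H.subalg by (auto simp: subalgebra_def)
  have [measurable]: "A \<in> sets M" using AG sub by blast
  define Y where "Y = (\<lambda>\<omega>. X \<omega> * indicator A \<omega>)"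
  have Y [measurable]: "Y \<in> borel_measurable M" by (simp add: Y_def)
  \<comment> \<open>the version that vanishes off \<open>A\<close> everywhere, not only almost surely\<close>
  define g where "g = (\<lambda>\<omega>. indicator A \<omega> * nn_cond_exp M G X \<omega>)"
  have gG: "g \<in> borel_measurable G" using AG by (simp add: g_def)
  have gH: "g \<in> borel_measurable H"
  proof (rule measurableI)
    fix S :: "ennreal set" assume S: "S \<in> sets borel"
    have 1: "g -` S \<inter> space G \<in> sets G" using gG S by (rule measurable_sets)
    have "g -` S \<inter> space H = (g -` S \<inter> space G) \<inter> A \<union> (if 0 \<in> S then space H - A else {})"
      using sets.sets_into_space[OF AH] by (auto simp: g_def spaces split: split_indicator_asm)
    also have "\<dots> \<in> sets H" using GH[OF 1] AH by auto
    finally show "g -` S \<inter> space H \<in> sets H" .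
  qed simp
  have 1: "AE \<omega> in M. g \<omega> = nn_cond_exp M G Y \<omega>"
    using G.nn_cond_exp_prod[of "indicator A" X] AG by (simp add: g_def Y_def mult.commute)
  have 2: "AE \<omega> in M. g \<omega> = nn_cond_exp M H Y \<omega>"
  proof (rule H.nn_cond_exp_charact)
    fix D assume D: "D \<in> sets H"
    have DA: "D \<inter> A \<in> sets G" by (rule HG[OF D])
    have "(\<integral>\<^sup>+\<omega>\<in>D. Y \<omega> \<partial>M) = (\<integral>\<^sup>+\<omega>. indicator (D \<inter> A) \<omega> * X \<omega> \<partial>M)"
      by (intro nn_integral_cong) (auto simp: Y_def split: split_indicator)
    also have "\<dots> = (\<integral>\<^sup>+\<omega>. indicator (D \<inter> A) \<omega> * nn_cond_exp M G X \<omega> \<partial>M)"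
      using DA by (intro G.nn_cond_exp_intg[symmetric]) auto
    also have "\<dots> = (\<integral>\<^sup>+\<omega>\<in>D. g \<omega> \<partial>M)"
      by (intro nn_integral_cong) (auto simp: g_def split: split_indicator)
    finally show "(\<integral>\<^sup>+\<omega>\<in>D. Y \<omega> \<partial>M) = (\<integral>\<^sup>+\<omega>\<in>D. g \<omega> \<partial>M)" .
  qed (use gH in auto)
  show ?thesis using 1 2 unfolding Y_def by eventually_elim simp
qed

section \<open>Announcing sequences\<close>

text \<open>
  The pathwise form of the requirement on an announcing sequence of a predictable time.
\<close>

definition announces :: "(nat \<Rightarrow> real) \<Rightarrow> real \<Rightarrow> bool" where
  "announces s t \<longleftrightarrow> incseq s \<and> s \<longlonglongrightarrow> t \<and> (0 < t \<longrightarrow> (\<forall>n. s n < t))"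

text \<open>
  Whether a predictable time comes no later than \<open>r\<close> can be read off the announcing times through
  strict inequalities only. These are the inequalities between stopping times that belong to the
  past of the earlier as well as to the strict past of the later time. The disjunct \<open>t = 0\<close> is
  needed because at \<open>t = 0\<close> the announcing sequence is not strictly smaller.
\<close>

lemma announces_less_iff_le:
  assumes s: "announces s t" and "0 \<le> t"
  shows "(\<forall>n. s n < r \<or> t = 0) \<longleftrightarrow> t = 0 \<or> t \<le> r"
proof
  assume *: "\<forall>n. s n < r \<or> t = 0"
  then have "s n \<le> r" if "t \<noteq> 0" for n using that by (auto intro: less_imp_le)
  then show "t = 0 \<or> t \<le> r" using s by (auto simp: announces_def intro: LIMSEQ_le_const2)
next
  assume "t = 0 \<or> t \<le> r"
  then show "\<forall>n. s n < r \<or> t = 0"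
    using s \<open>0 \<le> t\<close> by (cases "t = 0") (auto simp: announces_def intro: less_le_trans)
qed

text \<open>
  If only one of the limits is positive, the other sequence never exceeds zero, so the strict
  inequality survives; this is where the limits have to be nonnegative.
\<close>

lemma announces_max:
  assumes s: "announces s t" and u: "announces u v" and nn: "0 \<le> t" "0 \<le> v"
  shows "announces (\<lambda>n. max (s n) (u n)) (max t v)"
proof -
  have inc: "incseq s" "incseq u" and lim: "s \<longlonglongrightarrow> t" "u \<longlonglongrightarrow> v"
    and lt: "0 < t \<Longrightarrow> s n < t" "0 < v \<Longrightarrow> u n < v" for n
    using s u by (auto simp: announces_def)
  have le: "s n \<le> t" "u n \<le> v" for n
    using incseq_le[OF inc(1) lim(1)] incseq_le[OF inc(2) lim(2)] by auto
  have "incseq (\<lambda>n. max (s n) (u n))"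
    using inc by (intro incseq_SucI max.mono) (auto dest: incseq_SucD)
  moreover have "max (s n) (u n) < max t v" if "0 < max t v" for n
    using that nn lt[of n] le[of n] by (cases "t = 0"; cases "v = 0") (auto simp: less_max_iff_disj)
  ultimately show ?thesis using tendsto_max[OF lim] by (simp add: announces_def)
qed

section \<open>Stopping times with values in \<open>[0, T]\<close>\<close>

context usual_filtered_space
begin

lemma sets_F_subset: "t \<in> {0..T} \<Longrightarrow> sets (F t) \<subseteq> sets M"
  using subalgebra_F by (auto simp: subalgebra_def)

lemma measurable_stopping_times:
  assumes "S \<in> stopping_times M F T" shows "S \<in> borel_measurable M"
proof (rule borel_measurableI_le)
  fix t :: real
  have S: "stopping_time F S" "\<And>\<omega>. \<omega> \<in> space M \<Longrightarrow> S \<omega> \<in> {0..T}"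
    using assms by (auto simp: stopping_times_def)
  consider "t < 0" | "t \<in> {0..T}" | "T < t" by force
  then show "{\<omega> \<in> space M. S \<omega> \<le> t} \<in> sets M"
  proof cases
    case 1
    then have "{\<omega> \<in> space M. S \<omega> \<le> t} = {}" using S(2) by force
    then show ?thesis by (metis sets.empty_sets)
  next
    case 2
    then show ?thesis
      using stopping_timeD[OF S(1), of t] sets_F_subset[of t] by (auto simp: pred_def space_F)
  next
    case 3
    then have "{\<omega> \<in> space M. S \<omega> \<le> t} = space M" using S(2) by force
    then show ?thesis by simp
  qed
qed

lemma stopping_times_max:
  "S \<in> stopping_times M F T \<Longrightarrow> R \<in> stopping_times M F T \<Longrightarrow>
    (\<lambda>\<omega>. max (S \<omega>) (R \<omega>)) \<in> stopping_times M F T"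
  by (auto simp: stopping_times_def intro: stopping_time_max max.coboundedI1)

lemma stopping_times_min_const:
  "S \<in> stopping_times M F T \<Longrightarrow> 0 \<le> c \<Longrightarrow> (\<lambda>\<omega>. min (S \<omega>) c) \<in> stopping_times M F T"
  by (auto simp: stopping_times_def intro: stopping_time_min stopping_time_const min.coboundedI1)

text \<open>
  The restriction of \<open>S\<close> to \<open>C\<close> takes the value \<open>T\<close> off \<open>C\<close>, which within the horizon \<open>[0, T]\<close>
  plays the part of \<open>\<infinity>\<close>: stopping by time \<open>t < T\<close> requires \<open>C\<close>, and by \<open>T\<close> it is certain.
\<close>

lemma stopping_times_restrict:
  assumes S: "S \<in> stopping_times M F T" and C: "C \<in> sets (pre_sigma S)"
  shows "(\<lambda>\<omega>. if \<omega> \<in> C then S \<omega> else T) \<in> stopping_times M F T"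
proof -
  have S': "stopping_time F S" "\<And>\<omega>. \<omega> \<in> space M \<Longrightarrow> S \<omega> \<in> {0..T}"
    using S by (auto simp: stopping_times_def)
  have "stopping_time F (\<lambda>\<omega>. if \<omega> \<in> C then S \<omega> else T)"
  proof
    fix t
    have CM: "C \<subseteq> space M" using sets.sets_into_space[OF C] by (simp add: space_pre_sigma)
    have "{\<omega> \<in> space (F t). (if \<omega> \<in> C then S \<omega> else T) \<le> t} =
        (if T \<le> t then space (F t) else {\<omega> \<in> C. S \<omega> \<le> t})"
      using S'(2) CM by (force simp: space_F)
    also have "\<dots> \<in> sets (F t)" using sets_pre_sigmaD[OF S'(1) C] by simp
    finally show "Measurable.pred (F t) (\<lambda>\<omega>. (if \<omega> \<in> C then S \<omega> else T) \<le> t)"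
      by (simp add: pred_def)
  qed
  then show ?thesis using S'(2) horizon_pos by (auto simp: stopping_times_def)
qed

lemma less_in_pre_sigma:
  assumes "S \<in> stopping_times M F T" "R \<in> stopping_times M F T"
  shows "{\<omega> \<in> space M. S \<omega> < R \<omega>} \<in> sets (pre_sigma S)"
  using stopping_time_less[of S R] assms by (simp add: stopping_times_def pred_def space_pre_sigma)

lemma F0_subset_pre_sigma:
  assumes S: "S \<in> stopping_times M F T" and C: "C \<in> sets (F 0)"
  shows "C \<in> sets (pre_sigma S)"
proof (rule sets_pre_sigmaI)
  show S': "stopping_time F S" using S by (simp add: stopping_times_def)
  fix t
  have CM: "C \<subseteq> space M" using sets.sets_into_space[OF C] by (simp add: space_F)
  show "{\<omega> \<in> C. S \<omega> \<le> t} \<in> sets (F t)"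
  proof (cases "0 \<le> t")
    case True
    then have "C \<in> sets (F t)" using C sets_F_mono by blast
    moreover have "{\<omega> \<in> space M. S \<omega> \<le> t} \<in> sets (F t)"
      using stopping_timeD[OF S', of t] by (simp add: pred_def space_F)
    ultimately have "C \<inter> {\<omega> \<in> space M. S \<omega> \<le> t} \<in> sets (F t)" by blast
    also have "C \<inter> {\<omega> \<in> space M. S \<omega> \<le> t} = {\<omega> \<in> C. S \<omega> \<le> t}" using CM by auto
    finally show ?thesis .
  next
    case False
    then have "{\<omega> \<in> C. S \<omega> \<le> t} = {}" using S CM by (force simp: stopping_times_def)
    then show ?thesis by (metis sets.empty_sets)
  qed
qed

lemma pre_sigma_mono:
  assumes "S \<in> stopping_times M F T" "R \<in> stopping_times M F T"
    and "\<And>\<omega>. S \<omega> \<le> R \<omega>" and "C \<in> sets (pre_sigma S)"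
  shows "C \<in> sets (pre_sigma R)"
  using mono_pre_sigma[of S R] assms by (auto simp: stopping_times_def)

lemma eq_0_in_F0:
  assumes "S \<in> stopping_times M F T"
  shows "{\<omega> \<in> space M. S \<omega> = 0} \<in> sets (F 0)"
  using stopping_time_eq_const[of S 0] assms by (simp add: stopping_times_def pred_def space_F)

section \<open>The strict past\<close>

lemma strict_past_generators_closed:
  "sets (F 0) \<union> {A \<inter> {\<omega> \<in> space M. t < S \<omega>} |A t. t \<in> {0..T} \<and> A \<in> sets (F t)} \<subseteq> Pow (space M)"
  using sets.sets_into_space[of _ "F _"] by (auto simp: space_F)

lemma space_strict_past: "space (strict_past M F T S) = space M"
  unfolding strict_past_def by (rule space_measure_of[OF strict_past_generators_closed])

lemma sets_strict_past: "sets (strict_past M F T S) = sigma_sets (space M)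
    (sets (F 0) \<union> {A \<inter> {\<omega> \<in> space M. t < S \<omega>} |A t. t \<in> {0..T} \<and> A \<in> sets (F t)})"
  unfolding strict_past_def by (rule sets_measure_of[OF strict_past_generators_closed])

lemma F0_subset_strict_past: "C \<in> sets (F 0) \<Longrightarrow> C \<in> sets (strict_past M F T S)"
  by (auto simp: sets_strict_past)

lemma strict_past_generator:
  "t \<in> {0..T} \<Longrightarrow> C \<in> sets (F t) \<Longrightarrow> C \<inter> {\<omega> \<in> space M. t < S \<omega>} \<in> sets (strict_past M F T S)"
  unfolding sets_strict_past by (rule sigma_sets.Basic) blast

lemma subalgebra_strict_past:
  assumes "S \<in> stopping_times M F T"
  shows "subalgebra M (strict_past M F T S)"
proof -
  have [measurable]: "S \<in> borel_measurable M" by (rule measurable_stopping_times[OF assms])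
  have "C \<in> sets M" if "C \<in> sets (F t)" "t \<in> {0..T}" for C t
    using that sets_F_subset by blast
  moreover have "0 \<in> {0..T}" using horizon_pos by simp
  moreover have "{\<omega> \<in> space M. t < S \<omega>} \<in> sets M" for t by measurable
  ultimately have "sets (strict_past M F T S) \<subseteq> sets M"
    unfolding sets_strict_past by (intro sets.sigma_sets_subset) (blast intro: sets.Int)
  then show ?thesis by (simp add: subalgebra_def space_strict_past)
qed

lemma sigma_finite_subalgebra_strict_past:
  assumes "S \<in> stopping_times M F T"
  shows "sigma_finite_subalgebra M (strict_past M F T S)"
proof (rule finite_measure_subalgebra_is_sigma_finite)
  show "finite_measure_subalgebra M (strict_past M F T S)"
    by unfold_locales (rule subalgebra_strict_past[OF assms])
qed

text \<open>
  Null sets belong to \<open>F 0\<close>. This allows for announcing sequences that behave as required only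
  almost surely.
\<close>

lemma strict_past_AE_cong:
  assumes S: "S \<in> stopping_times M F T" and C: "C \<in> sets (strict_past M F T S)"
    and D: "D \<in> sets M" and eq: "AE \<omega> in M. \<omega> \<in> C \<longleftrightarrow> \<omega> \<in> D"
  shows "D \<in> sets (strict_past M F T S)"
proof -
  have CM: "C \<in> sets M" using C subalgebra_strict_past[OF S] by (auto simp: subalgebra_def)
  have "C - D \<in> null_sets M" "D - C \<in> null_sets M"
    using eq CM D by (auto intro!: AE_iff_null_sets[THEN iffD2])
  then have "C - D \<in> sets (strict_past M F T S)" "D - C \<in> sets (strict_past M F T S)"
    using complete_space(2) by (auto intro!: F0_subset_strict_past)
  then have "(C - (C - D)) \<union> (D - C) \<in> sets (strict_past M F T S)" using C by blast
  also have "(C - (C - D)) \<union> (D - C) = D" by auto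
  finally show ?thesis .
qed

lemma less_in_strict_past:
  assumes S: "S \<in> stopping_times M F T" and R: "R \<in> stopping_times M F T"
  shows "{\<omega> \<in> space M. S \<omega> < R \<omega>} \<in> sets (strict_past M F T R)"
proof -
  have "{\<omega> \<in> space M. S \<omega> < R \<omega>} =
      (\<Union>q\<in>\<rat> \<inter> {0..T}. {\<omega> \<in> space M. S \<omega> \<le> q} \<inter> {\<omega> \<in> space M. q < R \<omega>})" (is "?L = ?R")
  proof
    show "?L \<subseteq> ?R"
    proof
      fix \<omega> assume *: "\<omega> \<in> ?L"
      then obtain q where "q \<in> \<rat>" "S \<omega> < q" "q < R \<omega>" using Rats_dense_in_real by blast
      moreover have "0 \<le> S \<omega>" "R \<omega> \<le> T" using * S R by (auto simp: stopping_times_def)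
      ultimately show "\<omega> \<in> ?R" using * by (auto intro!: bexI[of _ q])
    qed
  qed auto
  also have "\<dots> \<in> sets (strict_past M F T R)"
  proof (intro sets.countable_UN'' countable_Int1 countable_rat strict_past_generator)
    show "{\<omega> \<in> space M. S \<omega> \<le> q} \<in> sets (F q)" for q
      using S stopping_timeD[of F S q] by (simp add: stopping_times_def pred_def space_F)
  qed auto
  finally show ?thesis .
qed

lemma predictable_times_stopping: "\<tau> \<in> predictable_times M F T \<Longrightarrow> \<tau> \<in> stopping_times M F T"
  by (simp add: predictable_times_def)

lemma predictable_timesE:
  assumes "\<tau> \<in> predictable_times M F T"
  obtains \<sigma> where "\<And>n. \<sigma> n \<in> stopping_times M F T" "AE \<omega> in M. announces (\<lambda>n. \<sigma> n \<omega>) (\<tau> \<omega>)"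
  using assms unfolding predictable_times_def announces_def by blast

text \<open>
  In contrast to the strict inequality above, this needs \<open>\<tau>\<close> to be predictable: up to the
  event \<open>{\<tau> = 0}\<close> and null sets, \<open>{\<tau> \<le> S}\<close> is the intersection of the events \<open>{\<sigma> n < S}\<close> for
  an announcing sequence \<open>\<sigma>\<close>.
\<close>

lemma le_in_strict_past:
  assumes \<tau>: "\<tau> \<in> predictable_times M F T" and S: "S \<in> stopping_times M F T"
  shows "{\<omega> \<in> space M. \<tau> \<omega> \<le> S \<omega>} \<in> sets (strict_past M F T S)"
proof -
  obtain \<sigma> where \<sigma>: "\<And>n. \<sigma> n \<in> stopping_times M F T"
    and ann: "AE \<omega> in M. announces (\<lambda>n. \<sigma> n \<omega>) (\<tau> \<omega>)"
    using predictable_timesE[OF \<tau>] by blast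
  note \<tau>s = predictable_times_stopping[OF \<tau>]
  note [measurable] = measurable_stopping_times[OF \<tau>s] measurable_stopping_times[OF S]
  let ?C = "\<Inter>n. {\<omega> \<in> space M. \<sigma> n \<omega> < S \<omega>} \<union> {\<omega> \<in> space M. \<tau> \<omega> = 0}"
  show ?thesis
  proof (rule strict_past_AE_cong[OF S, of ?C])
    have "{\<omega> \<in> space M. \<sigma> n \<omega> < S \<omega>} \<union> {\<omega> \<in> space M. \<tau> \<omega> = 0} \<in> sets (strict_past M F T S)" for n
      by (intro sets.Un less_in_strict_past \<sigma> S F0_subset_strict_past eq_0_in_F0 \<tau>s)
    then show "?C \<in> sets (strict_past M F T S)" by (intro sets.countable_INT) auto
    show "AE \<omega> in M. \<omega> \<in> ?C \<longleftrightarrow> \<omega> \<in> {\<omega> \<in> space M. \<tau> \<omega> \<le> S \<omega>}"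
      using ann
    proof (rule AE_mp, intro AE_I2 impI)
      fix \<omega> assume "\<omega> \<in> space M" and a: "announces (\<lambda>n. \<sigma> n \<omega>) (\<tau> \<omega>)"
      then have "0 \<le> \<tau> \<omega>" "0 \<le> S \<omega>" using \<tau>s S by (auto simp: stopping_times_def)
      with announces_less_iff_le[OF a, of "S \<omega>"] \<open>\<omega> \<in> space M\<close>
      show "\<omega> \<in> ?C \<longleftrightarrow> \<omega> \<in> {\<omega> \<in> space M. \<tau> \<omega> \<le> S \<omega>}" by auto
    qed
  qed measurable
qed

lemma eq_in_strict_past:
  assumes \<tau>: "\<tau> \<in> predictable_times M F T" and S: "S \<in> stopping_times M F T"
  shows "{\<omega> \<in> space M. \<tau> \<omega> = S \<omega>} \<in> sets (strict_past M F T S)"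
proof -
  have "{\<omega> \<in> space M. \<tau> \<omega> = S \<omega>} = {\<omega> \<in> space M. \<tau> \<omega> \<le> S \<omega>} - {\<omega> \<in> space M. \<tau> \<omega> < S \<omega>}" by auto
  then show ?thesis
    using le_in_strict_past[OF \<tau> S] less_in_strict_past[OF predictable_times_stopping[OF \<tau>] S] by auto
qed

text \<open>
  On \<open>A\<close> the generators \<open>D \<inter> {t < S}\<close> and \<open>D \<inter> {t < R}\<close> coincide, and the sets whose
  intersection with \<open>A\<close> lies in the strict past of \<open>R\<close> form a \<open>\<sigma>\<close>-field as soon as \<open>A\<close> itself
  lies there.
\<close>

lemma strict_past_trace:
  assumes A: "A \<in> sets (strict_past M F T R)" "\<And>\<omega>. \<omega> \<in> A \<Longrightarrow> S \<omega> = R \<omega>"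
    and C: "C \<in> sets (strict_past M F T S)"
  shows "C \<inter> A \<in> sets (strict_past M F T R)"
  using C unfolding sets_strict_past[of S]
proof (induction rule: sigma_sets.induct)
  case (Basic C)
  then consider "C \<in> sets (F 0)"
    | D t where "C = D \<inter> {\<omega> \<in> space M. t < S \<omega>}" "t \<in> {0..T}" "D \<in> sets (F t)" by blast
  then show ?case
  proof cases
    case 1 then show ?thesis using A(1) by (blast intro: F0_subset_strict_past)
  next
    case 2
    then have "C \<inter> A = (D \<inter> {\<omega> \<in> space M. t < R \<omega>}) \<inter> A" using A(2) by auto
    then show ?thesis using strict_past_generator[OF 2(2,3), of R] A(1) by auto
  qed
next
  case Empty then show ?case by simp
next
  case (Compl C)
  have "(space M - C) \<inter> A = A - C \<inter> A"
    using sets.sets_into_space[OF A(1)] by (auto simp: space_strict_past)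
  then show ?case using Compl.IH A(1) by auto
next
  case (Union C)
  have "(\<Union>i. C i) \<inter> A = (\<Union>i. C i \<inter> A)" by auto
  also have "\<dots> \<in> sets (strict_past M F T R)" using Union.IH by (intro sets.countable_UN) auto
  finally show ?case .
qed

section \<open>Restricting predictable times\<close>

text \<open>
  Suppose that \<open>C\<close> is decided by events \<open>D n\<close> that decrease to \<open>C\<close> and are known at the announcing
  times \<open>r n\<close>. Stop at \<open>r n\<close> while \<open>D n\<close> still holds and switch to \<open>T\<close> once it fails: as the \<open>D n\<close>
  decrease, this never requires to move back to an earlier time. The cap \<open>c n\<close> increases strictly
  below \<open>T\<close>, so that the value \<open>T\<close> off \<open>C\<close> is announced as well.
\<close>

lemma predictable_restrictI:
  assumes \<theta>: "(\<lambda>\<omega>. if \<omega> \<in> C then \<theta> \<omega> else T) \<in> stopping_times M F T"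
    and r: "\<And>n. r n \<in> stopping_times M F T" and D: "\<And>n. D n \<in> sets (pre_sigma (r n))"
    and ann: "AE \<omega> in M. incseq (\<lambda>n. r n \<omega>) \<and> (\<forall>n. \<omega> \<in> D (Suc n) \<longrightarrow> \<omega> \<in> D n) \<and>
      (\<omega> \<in> C \<longleftrightarrow> (\<forall>n. \<omega> \<in> D n)) \<and> (\<omega> \<in> C \<longrightarrow> announces (\<lambda>n. r n \<omega>) (\<theta> \<omega>))"
  shows "(\<lambda>\<omega>. if \<omega> \<in> C then \<theta> \<omega> else T) \<in> predictable_times M F T"
proof -
  \<comment> \<open>any sequence increasing strictly below \<open>T\<close> to \<open>T\<close>\<close>
  define c where "c n = T * (1 - inverse (real (Suc n)))" for n
  have c: "0 \<le> c n" "c n < T" "c n \<le> c (Suc n)" for n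
    using horizon_pos by (auto simp: c_def field_simps)
  have c_lim: "c \<longlonglongrightarrow> T"
    unfolding c_def using tendsto_mult[OF tendsto_const[of T] tendsto_diff[OF tendsto_const[of 1] LIMSEQ_inverse_real_of_nat]]
    by simp
  let ?r = "\<lambda>n \<omega>. min (if \<omega> \<in> D n then r n \<omega> else T) (c n)"
  have "AE \<omega> in M. announces (\<lambda>n. ?r n \<omega>) (if \<omega> \<in> C then \<theta> \<omega> else T)"
    using AE_space ann
  proof eventually_elim
    case (elim \<omega>)
    then have inc_r: "incseq (\<lambda>n. r n \<omega>)" and anti: "\<And>n. \<omega> \<in> D (Suc n) \<Longrightarrow> \<omega> \<in> D n"
      and CD: "\<omega> \<in> C \<longleftrightarrow> (\<forall>n. \<omega> \<in> D n)"
      and ann_r: "\<omega> \<in> C \<Longrightarrow> announces (\<lambda>n. r n \<omega>) (\<theta> \<omega>)" by blast+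
    have rT: "r n \<omega> \<le> T" for n using r elim(1) by (auto simp: stopping_times_def)
    have inc: "incseq (\<lambda>n. ?r n \<omega>)"
    proof (rule incseq_SucI)
      show "?r n \<omega> \<le> ?r (Suc n) \<omega>" for n
        using incseq_SucD[OF inc_r, of n] anti c(3)[of n] rT by (intro min.mono) auto
    qed
    show ?case
    proof (cases "\<omega> \<in> C")
      case True
      then have *: "\<omega> \<in> D n" for n using CD by blast
      have lim: "(\<lambda>n. r n \<omega>) \<longlonglongrightarrow> \<theta> \<omega>" and lt: "0 < \<theta> \<omega> \<Longrightarrow> r n \<omega> < \<theta> \<omega>" for n
        using ann_r[OF True] by (auto simp: announces_def)
      have "\<theta> \<omega> \<le> T" using lim rT by (intro LIMSEQ_le_const2) auto
      then have "(\<lambda>n. min (r n \<omega>) (c n)) \<longlonglongrightarrow> \<theta> \<omega>"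
        using tendsto_min[OF lim c_lim] by (simp add: min_absorb1)
      then show ?thesis using inc lt True * by (auto simp: announces_def min_less_iff_disj)
    next
      case False
      then obtain N where N: "\<omega> \<notin> D N" using CD by blast
      have "\<omega> \<notin> D n" if "N \<le> n" for n
        using that by (induction rule: dec_induct) (use N anti in auto)
      then have "c n = ?r n \<omega>" if "N \<le> n" for n using that c(2)[of n] by simp
      then have "\<forall>\<^sub>F n in sequentially. c n = ?r n \<omega>"
        unfolding eventually_sequentially by blast
      then have "(\<lambda>n. ?r n \<omega>) \<longlonglongrightarrow> T" using c_lim by (rule Lim_transform_eventually[rotated])
      then show ?thesis using inc False c(2) by (auto simp: announces_def min_less_iff_disj)
    qed
  qed
  moreover have "?r n \<in> stopping_times M F T" for n
    by (intro stopping_times_min_const stopping_times_restrict r D c)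
  ultimately show ?thesis
    unfolding predictable_times_def announces_def using \<theta>
    by (intro CollectI conjI exI[of _ ?r]) auto
qed

text \<open>
  Replacing the announcing times \<open>\<sigma> n\<close> of \<open>\<tau>\<close> by \<open>max (\<sigma> n) S\<close> still announces \<open>\<tau>\<close> on \<open>B\<close>. At
  these later times it is already known whether \<open>B\<close> occurs, so the deciding events can
  be taken constant.
\<close>

lemma predictable_restrict_after:
  assumes \<tau>: "\<tau> \<in> predictable_times M F T" and S: "S \<in> stopping_times M F T"
    and B: "B = {\<omega> \<in> space M. S \<omega> < \<tau> \<omega>}"
  shows "(\<lambda>\<omega>. if \<omega> \<in> B then \<tau> \<omega> else T) \<in> predictable_times M F T"
proof -
  obtain \<sigma> where \<sigma>: "\<And>n. \<sigma> n \<in> stopping_times M F T"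
    and ann: "AE \<omega> in M. announces (\<lambda>n. \<sigma> n \<omega>) (\<tau> \<omega>)"
    using predictable_timesE[OF \<tau>] by blast
  note \<tau>s = predictable_times_stopping[OF \<tau>]
  have BS: "B \<in> sets (pre_sigma S)" unfolding B by (rule less_in_pre_sigma[OF S \<tau>s])
  let ?r = "\<lambda>n \<omega>. max (\<sigma> n \<omega>) (S \<omega>)"
  note max_S = stopping_times_max[OF _ S]
  show ?thesis
  proof (rule predictable_restrictI[where r = ?r and D = "\<lambda>_. B"])
    have "(\<lambda>\<omega>. if \<omega> \<in> B then max (\<tau> \<omega>) (S \<omega>) else T) \<in> stopping_times M F T"
      by (rule stopping_times_restrict[OF max_S[OF \<tau>s] pre_sigma_mono[OF S max_S[OF \<tau>s] _ BS]]) simp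
    also have "(\<lambda>\<omega>. if \<omega> \<in> B then max (\<tau> \<omega>) (S \<omega>) else T) = (\<lambda>\<omega>. if \<omega> \<in> B then \<tau> \<omega> else T)"
      by (auto simp: B max_def)
    finally show "(\<lambda>\<omega>. if \<omega> \<in> B then \<tau> \<omega> else T) \<in> stopping_times M F T" .
    show "?r n \<in> stopping_times M F T" for n by (rule max_S[OF \<sigma>])
    show "B \<in> sets (pre_sigma (?r n))" for n
      by (rule pre_sigma_mono[OF S max_S[OF \<sigma>] _ BS]) simp
    show "AE \<omega> in M. incseq (\<lambda>n. ?r n \<omega>) \<and> (\<forall>n::nat. \<omega> \<in> B \<longrightarrow> \<omega> \<in> B) \<and>
        (\<omega> \<in> B \<longleftrightarrow> (\<forall>n::nat. \<omega> \<in> B)) \<and> (\<omega> \<in> B \<longrightarrow> announces (\<lambda>n. ?r n \<omega>) (\<tau> \<omega>))"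
      using ann
    proof eventually_elim
      case (elim \<omega>)
      then have inc: "incseq (\<lambda>n. ?r n \<omega>)"
        by (auto simp: announces_def mono_def intro: max.coboundedI1)
      have "(\<lambda>n. ?r n \<omega>) \<longlonglongrightarrow> max (\<tau> \<omega>) (S \<omega>)"
        using elim by (auto simp: announces_def intro: tendsto_max)
      then show ?case using elim inc by (auto simp: announces_def B max_absorb1)
    qed
  qed
qed

text \<open>
  That \<open>\<tau> = \<tau>'\<close> becomes visible in the limit: the events \<open>{\<sigma> n < \<tau>'}\<close> and \<open>{\<sigma>' n < \<tau>}\<close>, known
  at the times \<open>\<sigma> n\<close> and \<open>\<sigma>' n\<close>, decrease to \<open>{\<tau> \<le> \<tau>'}\<close> and \<open>{\<tau>' \<le> \<tau>}\<close>. The maximum in place of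
  \<open>\<theta>\<close> has announcing times beyond \<open>\<sigma> n\<close> and \<open>\<sigma>' n\<close>, at which these events are known; for
  \<open>\<theta> \<ge> \<tau>\<close> it equals \<open>\<theta>\<close> on \<open>A\<close>.
\<close>

lemma predictable_restrict_eq:
  assumes \<theta>: "\<theta> \<in> predictable_times M F T"
    and \<tau>: "\<tau> \<in> predictable_times M F T" and \<tau>': "\<tau>' \<in> predictable_times M F T"
    and A: "A = {\<omega> \<in> space M. \<tau> \<omega> = \<tau>' \<omega>}"
  shows "(\<lambda>\<omega>. if \<omega> \<in> A then max (\<theta> \<omega>) (max (\<tau> \<omega>) (\<tau>' \<omega>)) else T) \<in> predictable_times M F T"
proof -
  obtain \<rho> where \<rho>: "\<And>n. \<rho> n \<in> stopping_times M F T"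
    and ann\<rho>: "AE \<omega> in M. announces (\<lambda>n. \<rho> n \<omega>) (\<theta> \<omega>)"
    using predictable_timesE[OF \<theta>] by blast
  obtain \<sigma> where \<sigma>: "\<And>n. \<sigma> n \<in> stopping_times M F T"
    and ann\<sigma>: "AE \<omega> in M. announces (\<lambda>n. \<sigma> n \<omega>) (\<tau> \<omega>)"
    using predictable_timesE[OF \<tau>] by blast
  obtain \<sigma>' where \<sigma>': "\<And>n. \<sigma>' n \<in> stopping_times M F T"
    and ann\<sigma>': "AE \<omega> in M. announces (\<lambda>n. \<sigma>' n \<omega>) (\<tau>' \<omega>)"
    using predictable_timesE[OF \<tau>'] by blast
  note \<theta>s = predictable_times_stopping[OF \<theta>] and \<tau>s = predictable_times_stopping[OF \<tau>]
    and \<tau>'s = predictable_times_stopping[OF \<tau>']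
  let ?\<Theta> = "\<lambda>\<omega>. max (\<theta> \<omega>) (max (\<tau> \<omega>) (\<tau>' \<omega>))"
  let ?r = "\<lambda>n \<omega>. max (\<rho> n \<omega>) (max (\<sigma> n \<omega>) (\<sigma>' n \<omega>))"
  let ?D = "\<lambda>n. ({\<omega> \<in> space M. \<sigma> n \<omega> < \<tau>' \<omega>} \<union> {\<omega> \<in> space M. \<tau> \<omega> = 0}) \<inter>
                ({\<omega> \<in> space M. \<sigma>' n \<omega> < \<tau> \<omega>} \<union> {\<omega> \<in> space M. \<tau>' \<omega> = 0})"
  have \<Theta>: "?\<Theta> \<in> stopping_times M F T" by (intro stopping_times_max \<theta>s \<tau>s \<tau>'s)
  have r: "?r n \<in> stopping_times M F T" for n by (intro stopping_times_max \<rho> \<sigma> \<sigma>')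
  show ?thesis
  proof (rule predictable_restrictI[where r = ?r and D = ?D])
    have "{\<omega> \<in> space M. \<tau> \<omega> < \<tau>' \<omega>} \<in> sets (pre_sigma ?\<Theta>)"
      by (rule pre_sigma_mono[OF \<tau>s \<Theta> _ less_in_pre_sigma[OF \<tau>s \<tau>'s]]) simp
    moreover have "{\<omega> \<in> space M. \<tau>' \<omega> < \<tau> \<omega>} \<in> sets (pre_sigma ?\<Theta>)"
      by (rule pre_sigma_mono[OF \<tau>'s \<Theta> _ less_in_pre_sigma[OF \<tau>'s \<tau>s]]) simp
    ultimately have "space (pre_sigma ?\<Theta>) - ({\<omega> \<in> space M. \<tau> \<omega> < \<tau>' \<omega>} \<union> {\<omega> \<in> space M. \<tau>' \<omega> < \<tau> \<omega>})
        \<in> sets (pre_sigma ?\<Theta>)" by blast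
    also have "space (pre_sigma ?\<Theta>) - ({\<omega> \<in> space M. \<tau> \<omega> < \<tau>' \<omega>} \<union> {\<omega> \<in> space M. \<tau>' \<omega> < \<tau> \<omega>}) = A"
      by (auto simp: space_pre_sigma A)
    finally show "(\<lambda>\<omega>. if \<omega> \<in> A then ?\<Theta> \<omega> else T) \<in> stopping_times M F T"
      by (rule stopping_times_restrict[OF \<Theta>])
    show "?r n \<in> stopping_times M F T" for n by (rule r)
    show "?D n \<in> sets (pre_sigma (?r n))" for n
    proof -
      have "{\<omega> \<in> space M. \<sigma> n \<omega> < \<tau>' \<omega>} \<in> sets (pre_sigma (?r n))"
        by (rule pre_sigma_mono[OF \<sigma> r _ less_in_pre_sigma[OF \<sigma> \<tau>'s]]) simp
      moreover have "{\<omega> \<in> space M. \<sigma>' n \<omega> < \<tau> \<omega>} \<in> sets (pre_sigma (?r n))"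
        by (rule pre_sigma_mono[OF \<sigma>' r _ less_in_pre_sigma[OF \<sigma>' \<tau>s]]) simp
      moreover have "{\<omega> \<in> space M. \<tau> \<omega> = 0} \<in> sets (pre_sigma (?r n))"
        "{\<omega> \<in> space M. \<tau>' \<omega> = 0} \<in> sets (pre_sigma (?r n))"
        by (intro F0_subset_pre_sigma r eq_0_in_F0 \<tau>s \<tau>'s)+
      ultimately show ?thesis by blast
    qed
    show "AE \<omega> in M. incseq (\<lambda>n. ?r n \<omega>) \<and> (\<forall>n. \<omega> \<in> ?D (Suc n) \<longrightarrow> \<omega> \<in> ?D n) \<and>
        (\<omega> \<in> A \<longleftrightarrow> (\<forall>n. \<omega> \<in> ?D n)) \<and> (\<omega> \<in> A \<longrightarrow> announces (\<lambda>n. ?r n \<omega>) (?\<Theta> \<omega>))"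
      using AE_space ann\<rho> ann\<sigma> ann\<sigma>'
    proof eventually_elim
      case (elim \<omega>)
      have nn: "0 \<le> \<theta> \<omega>" "0 \<le> \<tau> \<omega>" "0 \<le> \<tau>' \<omega>"
        using elim(1) \<theta>s \<tau>s \<tau>'s by (auto simp: stopping_times_def)
      have ann: "announces (\<lambda>n. ?r n \<omega>) (?\<Theta> \<omega>)"
        using elim nn by (intro announces_max) auto
      have inc: "incseq (\<lambda>n. \<sigma> n \<omega>)" "incseq (\<lambda>n. \<sigma>' n \<omega>)"
        using elim by (auto simp: announces_def)
      have "\<omega> \<in> ?D (Suc n) \<longrightarrow> \<omega> \<in> ?D n" for n
        using incseq_SucD[OF inc(1), of n] incseq_SucD[OF inc(2), of n] by auto
      moreover have "\<omega> \<in> A \<longleftrightarrow> (\<forall>n. \<omega> \<in> ?D n)"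
      proof -
        have "\<omega> \<in> A \<longleftrightarrow> (\<tau> \<omega> = 0 \<or> \<tau> \<omega> \<le> \<tau>' \<omega>) \<and> (\<tau>' \<omega> = 0 \<or> \<tau>' \<omega> \<le> \<tau> \<omega>)"
          using elim(1) nn by (auto simp: A)
        also have "\<dots> \<longleftrightarrow> (\<forall>n. \<sigma> n \<omega> < \<tau>' \<omega> \<or> \<tau> \<omega> = 0) \<and> (\<forall>n. \<sigma>' n \<omega> < \<tau> \<omega> \<or> \<tau>' \<omega> = 0)"
          using announces_less_iff_le[OF elim(3) nn(2)] announces_less_iff_le[OF elim(4) nn(3)]
          by simp
        also have "\<dots> \<longleftrightarrow> (\<forall>n. \<omega> \<in> ?D n)" using elim(1) by auto
        finally show ?thesis .
      qed
      ultimately show ?case using ann unfolding announces_def by blast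
    qed
  qed
qed

section \<open>Comparison of the value functions\<close>

lemma admissible_measurable:
  assumes "admissible_family M F T \<phi>" "\<theta> \<in> predictable_times M F T"
  shows "\<phi> \<theta> \<in> borel_measurable M"
  using assms subalgebra_strict_past[OF predictable_times_stopping[OF assms(2)]]
  by (auto simp: admissible_family_def intro: measurable_from_subalg)

lemma
  fixes X :: "'i \<Rightarrow> 'a \<Rightarrow> ennreal"
  shows measurable_ess_sup_cond_exp:
      "ess_sup M I (\<lambda>\<theta>. nn_cond_exp M G (X \<theta>)) \<in> borel_measurable M" (is "?V \<in> _")
    and ess_sup_cond_exp_upper: "\<theta> \<in> I \<Longrightarrow>
      AE \<omega> in M. nn_cond_exp M G (X \<theta>) \<omega> \<le> ess_sup M I (\<lambda>\<theta>. nn_cond_exp M G (X \<theta>)) \<omega>"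
    and ess_sup_cond_exp_least: "Z \<in> borel_measurable M \<Longrightarrow>
      (\<And>\<theta>. \<theta> \<in> I \<Longrightarrow> AE \<omega> in M. nn_cond_exp M G (X \<theta>) \<omega> \<le> Z \<omega>) \<Longrightarrow>
      AE \<omega> in M. ess_sup M I (\<lambda>\<theta>. nn_cond_exp M G (X \<theta>)) \<omega> \<le> Z \<omega>"
proof -
  have "is_ess_sup M I (\<lambda>\<theta>. nn_cond_exp M G (X \<theta>)) ?V"
    by (rule is_ess_sup_ess_sup) (rule borel_measurable_nn_cond_exp2)
  note V = this[unfolded is_ess_sup_def]
  show "?V \<in> borel_measurable M" by (rule conjunct1[OF V])
  show "AE \<omega> in M. nn_cond_exp M G (X \<theta>) \<omega> \<le> ?V \<omega>" if "\<theta> \<in> I"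
    by (rule bspec[OF conjunct1[OF conjunct2[OF V]] that])
  show "AE \<omega> in M. ?V \<omega> \<le> Z \<omega>" if "Z \<in> borel_measurable M"
    and "\<And>\<theta>. \<theta> \<in> I \<Longrightarrow> AE \<omega> in M. nn_cond_exp M G (X \<theta>) \<omega> \<le> Z \<omega>"
    by (rule mp[OF bspec[OF conjunct2[OF conjunct2[OF V]] that(1)]]) (rule ballI, rule that(2))
qed

text \<open>
  By admissibility the reward localized to \<open>A\<close> depends on a competitor only through its values
  on \<open>A\<close>, and the two conditional expectations agree because the strict pasts have the same trace
  on \<open>A\<close>. An inclusion of the competitors up to their values off \<open>A\<close> thus bounds the suprema.
\<close>

lemma ess_sup_cond_exp_le_transfer:
  assumes \<phi>: "admissible_family M F T \<phi>"
    and \<tau>: "\<tau> \<in> predictable_times M F T" and \<tau>': "\<tau>' \<in> predictable_times M F T"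
    and A: "A = {\<omega> \<in> space M. \<tau> \<omega> = \<tau>' \<omega>}"
    and I: "I \<subseteq> predictable_times M F T" and J: "J \<subseteq> predictable_times M F T"
    and IJ: "\<And>\<theta>. \<theta> \<in> I \<Longrightarrow> \<exists>\<theta>'\<in>J. AE \<omega> in M. \<omega> \<in> A \<longrightarrow> \<theta> \<omega> = \<theta>' \<omega>"
  shows "AE \<omega> in M.
    ess_sup M I (\<lambda>\<theta>. nn_cond_exp M (strict_past M F T \<tau>) (\<lambda>\<omega>. \<phi> \<theta> \<omega> * indicator A \<omega>)) \<omega> \<le>
    ess_sup M J (\<lambda>\<theta>. nn_cond_exp M (strict_past M F T \<tau>') (\<lambda>\<omega>. \<phi> \<theta> \<omega> * indicator A \<omega>)) \<omega>"
    (is "AE \<omega> in M. ess_sup M I ?X \<omega> \<le> ess_sup M J ?Y \<omega>")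
proof -
  note \<tau>s = predictable_times_stopping[OF \<tau>] and \<tau>'s = predictable_times_stopping[OF \<tau>']
  have A\<tau>': "A \<in> sets (strict_past M F T \<tau>')" unfolding A by (rule eq_in_strict_past[OF \<tau> \<tau>'s])
  have A\<tau>: "A \<in> sets (strict_past M F T \<tau>)"
    using eq_in_strict_past[OF \<tau>' \<tau>s] unfolding A by (simp add: eq_commute)
  have [measurable]: "A \<in> sets M"
    using A\<tau> subalgebra_strict_past[OF \<tau>s] by (auto simp: subalgebra_def)
  have eq: "\<tau> \<omega> = \<tau>' \<omega>" if "\<omega> \<in> A" for \<omega> using that by (simp add: A)
  interpret \<tau>': sigma_finite_subalgebra M "strict_past M F T \<tau>'"
    by (rule sigma_finite_subalgebra_strict_past[OF \<tau>'s])
  have "AE \<omega> in M. ?X \<theta> \<omega> \<le> ess_sup M J ?Y \<omega>" if \<theta>I: "\<theta> \<in> I" for \<theta>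
  proof -
    obtain \<theta>' where \<theta>': "\<theta>' \<in> J" "AE \<omega> in M. \<omega> \<in> A \<longrightarrow> \<theta> \<omega> = \<theta>' \<omega>" using IJ[OF \<theta>I] by blast
    have p: "\<theta> \<in> predictable_times M F T" "\<theta>' \<in> predictable_times M F T" using \<theta>I \<theta>' I J by auto
    note [measurable] = admissible_measurable[OF \<phi> p(1)] admissible_measurable[OF \<phi> p(2)]
    have "AE \<omega> in M. \<theta> \<omega> = \<theta>' \<omega> \<longrightarrow> \<phi> \<theta> \<omega> = \<phi> \<theta>' \<omega>"
      using \<phi> p by (simp add: admissible_family_def)
    with \<theta>'(2) have "AE \<omega> in M. \<phi> \<theta> \<omega> * indicator A \<omega> = \<phi> \<theta>' \<omega> * indicator A \<omega>"
      by eventually_elim (auto split: split_indicator)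
    then have "AE \<omega> in M. ?Y \<theta> \<omega> = ?Y \<theta>' \<omega>" by (rule \<tau>'.nn_cond_exp_cong) measurable
    moreover have "AE \<omega> in M. ?X \<theta> \<omega> = ?Y \<theta> \<omega>"
      by (rule nn_cond_exp_eq_of_trace_eq[OF sigma_finite_subalgebra_strict_past[OF \<tau>s]
            sigma_finite_subalgebra_strict_past[OF \<tau>'s] A\<tau> A\<tau>'
            strict_past_trace[OF A\<tau>' eq] strict_past_trace[OF A\<tau> eq[symmetric]] admissible_measurable[OF \<phi> p(1)]])
    moreover have "AE \<omega> in M. ?Y \<theta>' \<omega> \<le> ess_sup M J ?Y \<omega>"
      by (rule ess_sup_cond_exp_upper[OF \<theta>'(1)])
    ultimately show ?thesis by eventually_elim simp
  qed
  then show ?thesis by (rule ess_sup_cond_exp_least[OF measurable_ess_sup_cond_exp])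
qed

text \<open>
  A competitor for \<open>\<tau>\<close> is kept on \<open>A\<close> and sent to the horizon \<open>T\<close> elsewhere. The value \<open>T\<close> is
  allowed after any time, also in the strict sense of the second claim, hence the result
  competes for \<open>\<tau>'\<close>.
\<close>

lemma value_on_le_of_times_eq:
  assumes \<phi>: "admissible_family M F T \<phi>"
    and \<tau>: "\<tau> \<in> predictable_times M F T" and \<tau>': "\<tau>' \<in> predictable_times M F T"
    and A: "A = {\<omega> \<in> space M. \<tau> \<omega> = \<tau>' \<omega>}"
  shows "AE \<omega> in M. value_on M F T \<phi> A \<tau> \<omega> \<le> value_on M F T \<phi> A \<tau>' \<omega>" (is ?on)
    and "AE \<omega> in M. value_on_plus M F T \<phi> A \<tau> \<omega> \<le> value_on_plus M F T \<phi> A \<tau>' \<omega>" (is ?plus)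
proof -
  define move where "move \<theta> = (\<lambda>\<omega>. if \<omega> \<in> A then max (\<theta> \<omega>) (max (\<tau> \<omega>) (\<tau>' \<omega>)) else T)"
    for \<theta> :: "'a \<Rightarrow> real"
  have pred: "move \<theta> \<in> predictable_times M F T" if "\<theta> \<in> predictable_times M F T" for \<theta>
    unfolding move_def by (rule predictable_restrict_eq[OF that \<tau> \<tau>' A])
  have bounds: "\<tau>' \<omega> \<le> T" "\<tau> \<omega> \<le> T" if "\<omega> \<in> space M" for \<omega>
    using \<tau> \<tau>' that by (auto simp: predictable_times_def stopping_times_def)
  have "\<exists>\<theta>'\<in>predictable_times_from M F T \<tau>'. AE \<omega> in M. \<omega> \<in> A \<longrightarrow> \<theta> \<omega> = \<theta>' \<omega>"
    if "\<theta> \<in> predictable_times_from M F T \<tau>" for \<theta>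
  proof (rule bexI[of _ "move \<theta>"])
    have \<theta>: "\<theta> \<in> predictable_times M F T" and le: "AE \<omega> in M. \<tau> \<omega> \<le> \<theta> \<omega>"
      using that by (auto simp: predictable_times_from_def)
    show "AE \<omega> in M. \<omega> \<in> A \<longrightarrow> \<theta> \<omega> = move \<theta> \<omega>"
      using le by eventually_elim (auto simp: move_def A)
    have "AE \<omega> in M. \<tau>' \<omega> \<le> move \<theta> \<omega>" by (rule AE_I2) (auto simp: move_def bounds)
    then show "move \<theta> \<in> predictable_times_from M F T \<tau>'"
      using pred[OF \<theta>] by (simp add: predictable_times_from_def)
  qed
  then show ?on unfolding value_on_def
    by (intro ess_sup_cond_exp_le_transfer[OF \<phi> \<tau> \<tau>' A]) (auto simp: predictable_times_from_def)
  have "\<exists>\<theta>'\<in>predictable_times_after M F T \<tau>'. AE \<omega> in M. \<omega> \<in> A \<longrightarrow> \<theta> \<omega> = \<theta>' \<omega>"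
    if "\<theta> \<in> predictable_times_after M F T \<tau>" for \<theta>
  proof (rule bexI[of _ "move \<theta>"])
    have \<theta>: "\<theta> \<in> predictable_times M F T"
      and gt: "AE \<omega> in M. (\<tau> \<omega> < T \<longrightarrow> \<tau> \<omega> < \<theta> \<omega>) \<and> (\<tau> \<omega> = T \<longrightarrow> \<theta> \<omega> = T)"
      using that by (auto simp: predictable_times_after_def)
    show "AE \<omega> in M. \<omega> \<in> A \<longrightarrow> \<theta> \<omega> = move \<theta> \<omega>"
      using AE_space gt by eventually_elim (use bounds in \<open>force simp: move_def A\<close>)
    have "AE \<omega> in M. (\<tau>' \<omega> < T \<longrightarrow> \<tau>' \<omega> < move \<theta> \<omega>) \<and> (\<tau>' \<omega> = T \<longrightarrow> move \<theta> \<omega> = T)"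
      using AE_space gt
      by eventually_elim (use bounds in \<open>auto simp: move_def A\<close>)
    then show "move \<theta> \<in> predictable_times_after M F T \<tau>'"
      using pred[OF \<theta>] by (simp add: predictable_times_after_def)
  qed
  then show ?plus unfolding value_on_plus_def
    by (intro ess_sup_cond_exp_le_transfer[OF \<phi> \<tau> \<tau>' A]) (auto simp: predictable_times_after_def)
qed

text \<open>
  The restriction of \<open>\<tau>\<close> to \<open>B\<close> is a predictable time strictly after \<open>S\<close>, and it has the same
  reward as \<open>\<tau>\<close> on \<open>B\<close>. As \<open>B\<close> belongs to the strict past of \<open>S\<close>, its indicator can be moved
  inside the conditional expectation.
\<close>

lemma cond_exp_le_value_on_plus:
  assumes \<phi>: "admissible_family M F T \<phi>"
    and \<tau>: "\<tau> \<in> predictable_times M F T" and S: "S \<in> stopping_times M F T"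
    and B: "B = {\<omega> \<in> space M. S \<omega> < \<tau> \<omega>}"
  shows "AE \<omega> in M. nn_cond_exp M (strict_past M F T S) (\<phi> \<tau>) \<omega> * indicator B \<omega>
    \<le> value_on_plus M F T \<phi> B S \<omega>"
proof -
  let ?\<theta> = "\<lambda>\<omega>. if \<omega> \<in> B then \<tau> \<omega> else T"
  let ?Y = "\<lambda>\<theta>. nn_cond_exp M (strict_past M F T S) (\<lambda>\<omega>. \<phi> \<theta> \<omega> * indicator B \<omega>)"
  interpret S: sigma_finite_subalgebra M "strict_past M F T S"
    by (rule sigma_finite_subalgebra_strict_past[OF S])
  have "B = space (strict_past M F T S) - {\<omega> \<in> space M. \<tau> \<omega> \<le> S \<omega>}"
    by (auto simp: B space_strict_past)
  then have BS [measurable]: "B \<in> sets (strict_past M F T S)" using le_in_strict_past[OF \<tau> S] by auto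
  then have [measurable]: "B \<in> sets M"
    using S.subalg by (auto simp: subalgebra_def)
  have \<theta>: "?\<theta> \<in> predictable_times M F T" by (rule predictable_restrict_after[OF \<tau> S B])
  note [measurable] = admissible_measurable[OF \<phi> \<tau>] admissible_measurable[OF \<phi> \<theta>]
  have "AE \<omega> in M. (S \<omega> < T \<longrightarrow> S \<omega> < ?\<theta> \<omega>) \<and> (S \<omega> = T \<longrightarrow> ?\<theta> \<omega> = T)"
  proof (rule AE_I2)
    fix \<omega> assume "\<omega> \<in> space M"
    moreover have "\<tau> \<omega> \<le> T"
      using calculation \<tau> by (auto simp: predictable_times_def stopping_times_def)
    ultimately show "(S \<omega> < T \<longrightarrow> S \<omega> < ?\<theta> \<omega>) \<and> (S \<omega> = T \<longrightarrow> ?\<theta> \<omega> = T)" by (auto simp: B)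
  qed
  with \<theta> have "?\<theta> \<in> predictable_times_after M F T S" by (simp add: predictable_times_after_def)
  then have le: "AE \<omega> in M. ?Y ?\<theta> \<omega> \<le> value_on_plus M F T \<phi> B S \<omega>"
    unfolding value_on_plus_def by (rule ess_sup_cond_exp_upper)
  have "AE \<omega> in M. \<tau> \<omega> = ?\<theta> \<omega> \<longrightarrow> \<phi> \<tau> \<omega> = \<phi> ?\<theta> \<omega>"
    using \<phi> \<tau> \<theta> by (simp add: admissible_family_def)
  then have "AE \<omega> in M. \<phi> \<tau> \<omega> * indicator B \<omega> = \<phi> ?\<theta> \<omega> * indicator B \<omega>"
    by eventually_elim (auto split: split_indicator)
  then have "AE \<omega> in M. ?Y \<tau> \<omega> = ?Y ?\<theta> \<omega>" by (rule S.nn_cond_exp_cong) measurable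
  moreover have "AE \<omega> in M. nn_cond_exp M (strict_past M F T S) (\<phi> \<tau>) \<omega> * indicator B \<omega> = ?Y \<tau> \<omega>"
    using S.nn_cond_exp_prod[of "indicator B" "\<phi> \<tau>"] by (simp add: mult.commute)
  ultimately show ?thesis using le by eventually_elim simp
qed

end

theorem mainTheorem4:
  fixes M :: "'a measure" and F :: "real \<Rightarrow> 'a measure" and T :: real
    and \<phi> :: "('a \<Rightarrow> real) \<Rightarrow> 'a \<Rightarrow> ennreal"
    and \<tau> \<tau>' :: "'a \<Rightarrow> real" and A B :: "'a set"
  assumes "usual_filtered_space M F T"
    and "\<not> quasi_left_continuous M F T"
    and "admissible_family M F T \<phi>"
    and "\<tau> \<in> predictable_times M F T" and "\<tau>' \<in> predictable_times M F T"
    and "A = {\<omega> \<in> space M. \<tau> \<omega> = \<tau>' \<omega>}"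
    and "B = {\<omega> \<in> space M. \<tau> \<omega> > \<tau>' \<omega>}"
  shows "(AE \<omega> in M. value_on M F T \<phi> A \<tau> \<omega> = value_on M F T \<phi> A \<tau>' \<omega>) \<and>
    (AE \<omega> in M. value_on_plus M F T \<phi> A \<tau> \<omega> = value_on_plus M F T \<phi> A \<tau>' \<omega>) \<and>
    (AE \<omega> in M. nn_cond_exp M (strict_past M F T \<tau>') (\<phi> \<tau>) \<omega> * indicator B \<omega>
       \<le> value_on_plus M F T \<phi> B \<tau>' \<omega>)"
proof -
  interpret usual_filtered_space M F T by (rule assms(1))
  have A': "A = {\<omega> \<in> space M. \<tau>' \<omega> = \<tau> \<omega>}" using assms(6) by auto
  note le = value_on_le_of_times_eq[OF assms(3-6)] and ge = value_on_le_of_times_eq[OF assms(3,5,4) A']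
  show ?thesis
  proof (intro conjI)
    show "AE \<omega> in M. value_on M F T \<phi> A \<tau> \<omega> = value_on M F T \<phi> A \<tau>' \<omega>"
      using le(1) ge(1) by eventually_elim simp
    show "AE \<omega> in M. value_on_plus M F T \<phi> A \<tau> \<omega> = value_on_plus M F T \<phi> A \<tau>' \<omega>"
      using le(2) ge(2) by eventually_elim simp
    show "AE \<omega> in M. nn_cond_exp M (strict_past M F T \<tau>') (\<phi> \<tau>) \<omega> * indicator B \<omega>
       \<le> value_on_plus M F T \<phi> B \<tau>' \<omega>"
      by (rule cond_exp_le_value_on_plus[OF assms(3,4) predictable_times_stopping[OF assms(5)] assms(7)])
  qed
qed

end
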